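(* Let $\alpha,\beta,\gamma,\delta,b$ be constants with $\gamma+\delta\neq0$, $(\alpha\gamma,\beta\delta)\neq(0,0)$ and $b\neq0$. Consider the linear problem $$\psi_{n,y}=q_n\left(\gamma\phi_n+\delta\phi_{n+1}\right),\qquad \phi_{n+1}-\phi_n=r_n\psi_n, \qquad (\mathrm{A})$$ together with the time evolution $$\begin{aligned}\mathrm{i}\psi_{n,t}={}&\alpha u_n^{\gamma}\psi_{n-1}+\beta u_{n+1}^{\delta}\psi_{n+1}+w_n\psi_n\\&+b\Big\{(\gamma+\delta)q_n\phi_{n,y}-(\gamma+\delta)\left(q_{n,y}-\delta q_nr_nq_n\right)\phi_n\\&\qquad-\delta\left[\left(q_{n,y}r_n-q_nr_{n,y}\right)+(\gamma-\delta)\left(q_nr_n\right)^2\right]\psi_n\Big\},\end{aligned}$$ $$\mathrm{i}\phi_{n,t}=-\alpha u_n^{\gamma}r_n\psi_{n-1}+\beta u_n^{\delta}r_{n-1}\psi_n+b\left[\phi_{n,yy}+(\gamma+\delta)v_n\phi_n\right]. \qquad (\mathrm{B})$$ Then the compatibility conditions of the overdetermined linear systems (A) and (B) for $\psi_n$ and $\phi_n$ are equivalent to the system of differential-difference equations $$\mathrm{i}q_{n,t}-\alpha u_n^{\gamma}q_{n-1}-\beta u_{n+1}^{\delta}q_{n+1}-w_nq_n+b\left[q_{n,yy}+q_n\left(\gamma v_n+\delta v_{n+1}\right)+\gamma\delta\left(q_nr_n\right)^2q_n\right]=0,$$ $$\mathrm{i}r_{n,t}+\beta u_n^{\delta}r_{n-1}+\alpha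 u_{n+1}^{\gamma}r_{n+1}+w_nr_n-b\left[r_{n,yy}+\left(\delta v_n+\gamma v_{n+1}\right)r_n+\gamma\delta\, r_n\left(q_nr_n\right)^2\right]=0,$$ $$u_{n,y}=u_n\left(q_{n-1}r_{n-1}-q_nr_n\right),$$ $$w_{n,y}=\alpha\delta\left(u_n^{\gamma}q_{n-1}r_n-u_{n+1}^{\gamma}q_nr_{n+1}\right)+\beta\gamma\left(u_n^{\delta}q_nr_{n-1}-u_{n+1}^{\delta}q_{n+1}r_n\right),$$ $$v_{n+1}-v_n=-2\left(r_nq_n\right)_y$$ (for all $n\in\mathbb{Z}$).
   Context: Here $n\in\mathbb{Z}$ is a discrete variable, $y$ and $t$ are continuous variables, and subscripts $y,t$ denote partial differentiation. All functions are smooth in the continuous variables. For a fixed positive integer $M$: $q_n$ is an $M$-component row vector, $r_n$ an $M$-component column vector, $u_n,w_n$ are scalars, $v_n$ is an $M\times M$ matrix, $\psi_n$ is a scalar and $\phi_n$ an $M$-component column vector; thus $q_mr_n$ and $q_m\phi_n$ are scalars and $r_nq_n$ is an $M\times M$ matrix. The scalar $u_n$ is nowhere zero, a smooth branch of $\log u_n$ is fixed, and $u_n^{c}:=\exp(c\log u_n)$. "Compatibility conditions" of (A) and (B) means the requirements $\psi_{n,yt}=\psi_{n,ty}$ and $(r_n\psi_n+\phi_n-\phi_{n+1})_t=0$ for all $n$, where all derivatives of $\psi$ with respect to $y,t$ and of $\phi$ with respect to $t$, and the shifts of $\phi_n$ in $n$, are evaluated by means of (A) and (B), imposed for generic $\psi_n,\phi_n$: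 after using (A) and (B) to express everything linearly in $\psi_{n-1},\psi_n,\psi_{n+1}$, $\phi_n$ and the $y$-derivatives of $\phi_n$, these quantities are regarded as independent, so each coefficient must vanish. *)

theory Defs
  imports "HOL-Analysis.Analysis"
begin

text \<open>Functions of the continuous variables are curried, with argument order \<open>y\<close>, \<open>t\<close>;
  the discrete variable \<open>n\<close>, if present, comes first.\<close>

definition dy :: "(real \<Rightarrow> real \<Rightarrow> 'a::real_normed_vector) \<Rightarrow> real \<Rightarrow> real \<Rightarrow> 'a" where
  "dy f y t = vector_derivative (\<lambda>s. f s t) (at y)"

definition dt :: "(real \<Rightarrow> real \<Rightarrow> 'a::real_normed_vector) \<Rightarrow> real \<Rightarrow> real \<Rightarrow> 'a" where
  "dt f y t = vector_derivative (\<lambda>s. f y s) (at t)"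

text \<open>Joint \<open>C\<^sup>\<infinity>\<close> smoothness: all iterated partial derivatives exist and are (Frechet)
  differentiable on the whole plane.\<close>

coinductive smooth :: "(real \<Rightarrow> real \<Rightarrow> 'a::real_normed_vector) \<Rightarrow> bool" where
  "(\<lambda>(y, t). f y t) differentiable_on UNIV \<Longrightarrow> smooth (dy f) \<Longrightarrow> smooth (dt f) \<Longrightarrow> smooth f"

text \<open>Row and column vectors are both of type \<open>complex ^ 'm\<close>. The product row times column is
  the bilinear \<open>q \<odot> r\<close> (no complex conjugation), column times row is the matrix
  \<open>outer r q\<close>, and row times matrix is the library's \<open>q v* A\<close>.\<close>

definition rowcol :: "complex ^ 'm \<Rightarrow> complex ^ 'm \<Rightarrow> complex" (infixl \<open>\<odot>\<close> 70) where
  "q \<odot> r = (\<Sum>i\<in>UNIV. q $ i * r $ i)"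

definition outer :: "complex ^ 'm \<Rightarrow> complex ^ 'm \<Rightarrow> complex ^ 'm ^ 'm" where
  "outer r q = (\<chi> i j. r $ i * q $ j)"

definition matscale :: "complex \<Rightarrow> complex ^ 'm ^ 'm \<Rightarrow> complex ^ 'm ^ 'm" (infixl \<open>*\<^sub>m\<close> 70) where
  "c *\<^sub>m A = (\<chi> i j. c * A $ i $ j)"

text \<open>The independent quantities at a fixed point \<open>(y, t)\<close>, relative to a base site \<open>n\<close>:
  a jet \<open>J\<close> consists of the values \<open>fst J m\<close> of \<open>\<psi>\<^sub>m\<close> at all sites \<open>m\<close> and the values
  \<open>snd J k\<close> of the \<open>k\<close>-th \<open>y\<close>-derivative of \<open>\<phi>\<^sub>n\<close> at the base site only. There is no
  constraint between them: the \<open>y\<close>-derivatives of all \<open>\<psi>\<^sub>m\<close> and the \<open>\<phi>\<^sub>m\<close> with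
  \<open>m \<noteq> n\<close> are eliminated by means of the linear problem.\<close>

type_synonym 'm jet = "(int \<Rightarrow> complex) \<times> (nat \<Rightarrow> complex ^ 'm)"

text \<open>A \<open>form\<close> is an expression in these quantities with coefficients depending on \<open>(y, t)\<close>.
  Only expressions that are linear in the jet occur below.\<close>

type_synonym ('m, 'a) form = "real \<Rightarrow> real \<Rightarrow> 'm jet \<Rightarrow> 'a"

locale lax_pair =
  fixes \<alpha> \<beta> \<gamma> \<delta> b :: complex
    and q r :: "int \<Rightarrow> real \<Rightarrow> real \<Rightarrow> complex ^ 'm"
    and logu w :: "int \<Rightarrow> real \<Rightarrow> real \<Rightarrow> complex"
    and v :: "int \<Rightarrow> real \<Rightarrow> real \<Rightarrow> complex ^ 'm ^ 'm"
begin

text \<open>\<open>upow c n\<close> is the power \<open>u\<^sub>n\<^sup>c\<close> for the chosen branch \<open>logu\<close> of \<open>log u\<close>.\<close>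

definition upow :: "complex \<Rightarrow> int \<Rightarrow> real \<Rightarrow> real \<Rightarrow> complex" where
  "upow c n y t = exp (c * logu n y t)"

definition psi :: "int \<Rightarrow> ('m, complex) form" where
  "psi m y t J = fst J m"

text \<open>\<open>phi n m\<close> is \<open>\<phi>\<^sub>m\<close> in terms of jets based at \<open>n\<close>, obtained by iterating
  \<open>\<phi>\<^sub>m\<^sub>+\<^sub>1 = \<phi>\<^sub>m + r\<^sub>m \<psi>\<^sub>m\<close> upwards (\<open>m > n\<close>) or downwards (\<open>m < n\<close>).\<close>

definition phi :: "int \<Rightarrow> int \<Rightarrow> ('m, complex ^ 'm) form" where
  "phi n m y t J = snd J 0
     + (\<Sum>k\<in>{n..<m}. psi k y t J *s r k y t) - (\<Sum>k\<in>{m..<n}. psi k y t J *s r k y t)"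

text \<open>The right-hand side of the first equation of the linear problem at site \<open>m\<close>.\<close>

definition psi_y :: "int \<Rightarrow> int \<Rightarrow> ('m, complex) form" where
  "psi_y n m y t J = q m y t \<odot> (\<gamma> *s phi n m y t J + \<delta> *s phi n (m + 1) y t J)"

text \<open>The jet of \<open>y\<close>-derivatives of the independent quantities, and the resulting total
  \<open>y\<close>-derivative: by linearity in the jet, the product rule splits it into the derivative
  of the coefficients plus the form evaluated at the differentiated jet.\<close>

definition jet_y :: "int \<Rightarrow> real \<Rightarrow> real \<Rightarrow> 'm jet \<Rightarrow> 'm jet" where
  "jet_y n y t J = ((\<lambda>m. psi_y n m y t J), (\<lambda>k. snd J (Suc k)))"

definition Dy :: "int \<Rightarrow> ('m, 'a::real_normed_vector) form \<Rightarrow> ('m, 'a) form" where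
  "Dy n F y t J = dy (\<lambda>y t. F y t J) y t + F y t (jet_y n y t J)"

text \<open>The time derivatives of \<open>\<psi>\<^sub>n\<close> and of \<open>\<phi>\<^sub>m\<close> prescribed by the time evolution,
  in terms of jets based at \<open>n\<close>.\<close>

definition psi_t :: "int \<Rightarrow> ('m, complex) form" where
  "psi_t n y t J = (1 / \<i>) *
    (\<alpha> * upow \<gamma> n y t * psi (n - 1) y t J
     + \<beta> * upow \<delta> (n + 1) y t * psi (n + 1) y t J
     + w n y t * psi n y t J
     + b * ((\<gamma> + \<delta>) * (q n y t \<odot> Dy n (phi n n) y t J)
          - (\<gamma> + \<delta>) * ((dy (q n) y t - (\<delta> * (q n y t \<odot> r n y t)) *s q n y t) \<odot> phi n n y t J)
          - \<delta> * ((dy (q n) y t \<odot> r n y t - q n y t \<odot> dy (r n) y t)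
                 + (\<gamma> - \<delta>) * (q n y t \<odot> r n y t)\<^sup>2) * psi n y t J))"

definition phi_t :: "int \<Rightarrow> int \<Rightarrow> ('m, complex ^ 'm) form" where
  "phi_t n m y t J = (1 / \<i>) *s
    (- ((\<alpha> * upow \<gamma> m y t * psi (m - 1) y t J) *s r m y t)
     + (\<beta> * upow \<delta> m y t * psi m y t J) *s r (m - 1) y t
     + b *s (Dy n (Dy n (phi n m)) y t J + (\<gamma> + \<delta>) *s (v m y t *v phi n m y t J)))"

text \<open>The two cross derivatives of \<open>\<psi>\<^sub>n\<close>: the \<open>t\<close>-derivative of
  \<open>q\<^sub>n (\<gamma> \<phi>\<^sub>n + \<delta> \<phi>\<^sub>n\<^sub>+\<^sub>1)\<close>, and the \<open>y\<close>-derivative of \<open>\<psi>\<^sub>n\<^sub>,\<^sub>t\<close>.\<close>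

definition psi_yt :: "int \<Rightarrow> ('m, complex) form" where
  "psi_yt n y t J =
     dt (q n) y t \<odot> (\<gamma> *s phi n n y t J + \<delta> *s phi n (n + 1) y t J)
     + q n y t \<odot> (\<gamma> *s phi_t n n y t J + \<delta> *s phi_t n (n + 1) y t J)"

definition psi_ty :: "int \<Rightarrow> ('m, complex) form" where
  "psi_ty n = Dy n (psi_t n)"

text \<open>The \<open>t\<close>-derivative of \<open>r\<^sub>n \<psi>\<^sub>n + \<phi>\<^sub>n - \<phi>\<^sub>n\<^sub>+\<^sub>1\<close>. Both \<open>\<phi>\<^sub>n\<close> and \<open>\<phi>\<^sub>n\<^sub>+\<^sub>1\<close>
  are differentiated by the time evolution at their own site.\<close>

definition shift_t :: "int \<Rightarrow> ('m, complex ^ 'm) form" where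
  "shift_t n y t J =
     psi n y t J *s dt (r n) y t + psi_t n y t J *s r n y t
     + phi_t n n y t J - phi_t n (n + 1) y t J"

text \<open>Compatibility holds for arbitrary values of the independent quantities; as both sides
  are linear in \<open>J\<close>, this says that the coefficient of each of them vanishes.\<close>

definition compatible :: bool where
  "compatible \<longleftrightarrow> (\<forall>n y t J. psi_yt n y t J = psi_ty n y t J \<and> shift_t n y t J = 0)"

end

end

theory Submission
  imports Defs
begin

text \<open>Write \<open>Q, R, U, W, V\<close> for the differences of the two sides of the five lattice equations
  (with the third one divided by \<open>u\<close>, that is, stated for \<open>log u\<close>). Eliminating everything in
  favour of the jet yields two identities that hold for arbitrary smooth fields:
  up to the factor \<open>\<i>\<close>, the defect of the shift equation is
  \<open>\<psi>\<^sub>n (R - b\<delta> V r\<^sub>n) - b(\<gamma>+\<delta>) V \<phi>\<^sub>n\<close> and the defect of the cross derivatives of \<open>\<psi>\<^sub>n\<close> is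
  \<open>(\<gamma>+\<delta>) Q \<phi>\<^sub>n + \<psi>\<^sub>n (\<delta> Q r\<^sub>n - W + b\<gamma>\<delta> q\<^sub>n V r\<^sub>n) - \<alpha>\<gamma> u\<^sub>n\<^sup>\<gamma> U\<^sub>n \<psi>\<^sub>n\<^sub>-\<^sub>1 - \<beta>\<delta> u\<^sub>n\<^sub>+\<^sub>1\<^sup>\<delta> U\<^sub>n\<^sub>+\<^sub>1 \<psi>\<^sub>n\<^sub>+\<^sub>1\<close>.
  The coefficients vanish successively: \<open>V\<close>, \<open>R\<close>, \<open>Q\<close>, \<open>W\<close>, and finally \<open>U\<close>, for which one of
  \<open>\<alpha>\<gamma>\<close>, \<open>\<beta>\<delta>\<close> being nonzero suffices since \<open>n\<close> is arbitrary.\<close>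

section \<open>Partial derivatives of jointly smooth functions\<close>

lemma smooth_dy: "smooth f \<Longrightarrow> smooth (dy f)"
  by (erule smooth.cases) simp

text \<open>Chain rule: the function of \<open>y\<close> alone is the joint function composed with
  the affine embedding of a horizontal line.\<close>

lemma smooth_has_dy:
  assumes "smooth f"
  shows "((\<lambda>s. f s t) has_vector_derivative dy f y t) (at y)"
proof -
  have "(\<lambda>(y, t). f y t) differentiable at (y, t)"
    using assms by cases (simp add: differentiable_on_def)
  moreover have "(\<lambda>s. (s, t)) differentiable at y"
    unfolding differentiable_def by (auto intro!: derivative_eq_intros)
  ultimately have "((\<lambda>(y, t). f y t) \<circ> (\<lambda>s. (s, t))) differentiable at y"
    by (intro differentiable_chain_at)
  then show ?thesis
    unfolding dy_def by (simp add: o_def vector_derivative_works)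
qed

lemma dy_eqI: "((\<lambda>s. f s t) has_vector_derivative D) (at y) \<Longrightarrow> dy f y t = D"
  unfolding dy_def by (rule vector_derivative_at)

section \<open>Bilinear products of rows, columns and matrices\<close>

lemma bounded_bilinear_rowcol: "bounded_bilinear (\<odot>)"
  unfolding bilinear_conv_bounded_bilinear[symmetric] bilinear_def
  by (auto intro!: linearI simp: rowcol_def algebra_simps sum.distrib sum_distrib_left scaleR_sum_right)

lemma bounded_bilinear_vector_smult: "bounded_bilinear (\<lambda>c (x :: complex ^ 'm). c *s x)"
  unfolding bilinear_conv_bounded_bilinear[symmetric] bilinear_def
  by (auto intro!: linearI simp: vec_eq_iff algebra_simps)

lemma bounded_bilinear_outer: "bounded_bilinear (outer :: complex ^ 'm \<Rightarrow> _)"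
  unfolding bilinear_conv_bounded_bilinear[symmetric] bilinear_def
  by (auto intro!: linearI simp: vec_eq_iff outer_def algebra_simps)

text \<open>In finite dimension real bilinearity already gives boundedness, so each product obeys
  the Leibniz rule.\<close>

lemmas has_vector_derivative_bilinear_intros [derivative_intros] =
  bounded_bilinear.has_vector_derivative[OF bounded_bilinear_rowcol]
  bounded_bilinear.has_vector_derivative[OF bounded_bilinear_vector_smult]
  bounded_bilinear.has_vector_derivative[OF bounded_bilinear_outer]

lemmas rowcol_linear_simps =
  bounded_bilinear.add_left[OF bounded_bilinear_rowcol]
  bounded_bilinear.add_right[OF bounded_bilinear_rowcol]
  bounded_bilinear.diff_left[OF bounded_bilinear_rowcol]
  bounded_bilinear.diff_right[OF bounded_bilinear_rowcol]
  bounded_bilinear.minus_left[OF bounded_bilinear_rowcol]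
  bounded_bilinear.minus_right[OF bounded_bilinear_rowcol]
  bounded_bilinear.zero_left[OF bounded_bilinear_rowcol]
  bounded_bilinear.zero_right[OF bounded_bilinear_rowcol]

lemma rowcol_smult [simp]: "(c *s q) \<odot> r = c * (q \<odot> r)" "q \<odot> (c *s r) = c * (q \<odot> r)"
  by (auto simp: rowcol_def sum_distrib_left mult_ac)

text \<open>Moves matrices off row vectors, so that in the final identities they act only on
  columns.\<close>

lemma rowcol_matrix_vector: "(q v* A) \<odot> x = q \<odot> (A *v x)"
  unfolding rowcol_def matrix_vector_mult_def vector_matrix_mult_def
  by (simp add: sum_distrib_left sum_distrib_right mult_ac) (rule sum.swap)

lemma outer_vector: "outer r q *v x = (q \<odot> x) *s r"
  by (simp add: vec_eq_iff outer_def matrix_vector_mult_def rowcol_def sum_distrib_left mult_ac)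

lemma matscale_vector: "(c *\<^sub>m A) *v x = c *s (A *v x)"
  by (simp add: vec_eq_iff matscale_def matrix_vector_mult_def sum_distrib_left mult_ac)

text \<open>Nondegeneracy of the pairing, tested on unit vectors; it turns a vanishing coefficient
  of \<open>phi\<close> into a vector equation.\<close>

lemma rowcol_eq_0_imp: "(\<And>x. q \<odot> x = 0) \<Longrightarrow> q = 0"
proof -
  assume a: "\<And>x. q \<odot> x = 0"
  have "q $ i = 0" for i
    using a[of "axis i 1"] by (simp add: rowcol_def axis_def if_distrib cong: if_cong)
  then show "q = 0" by (simp add: vec_eq_iff)
qed

lemma vector_matscale_combination: "q v* (c *\<^sub>m A + d *\<^sub>m B) = c *s (q v* A) + d *s (q v* B)"
  by (simp add: vec_eq_iff matscale_def vector_matrix_mult_def sum_distrib_left sum.distrib algebra_simps)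

section \<open>Forms near the base site and their total \<open>y\<close>-derivatives\<close>

locale smooth_lax_pair = lax_pair +
  assumes smooth_q: "\<And>n. smooth (q n)" and smooth_r: "\<And>n. smooth (r n)"
    and smooth_w: "\<And>n. smooth (w n)" and smooth_logu: "\<And>n. smooth (logu n)"
begin

lemmas has_dy [derivative_intros] =
  smooth_q[THEN smooth_has_dy] smooth_r[THEN smooth_has_dy] smooth_w[THEN smooth_has_dy]
  smooth_logu[THEN smooth_has_dy]
  smooth_q[THEN smooth_dy, THEN smooth_has_dy] smooth_r[THEN smooth_dy, THEN smooth_has_dy]

lemma Dy_eqI:
  assumes "((\<lambda>s. F s t J) has_vector_derivative D) (at y)"
  shows "Dy n F y t J = D + F y t (jet_y n y t J)"
  unfolding Dy_def using dy_eqI[of "\<lambda>y t. F y t J", OF assms] by simp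

text \<open>These four sites suffice: \<open>psi_t\<close> involves \<open>psi\<close> at
  \<open>n - 1\<close>, \<open>n\<close> and \<open>n + 1\<close>, whose
  \<open>y\<close>-derivatives reach from \<open>phi n (n - 1)\<close> to
  \<open>phi n (n + 2)\<close>.\<close>

lemma phi_near:
  "phi n n y t J = snd J 0"
  "phi n (n + 1) y t J = snd J 0 + fst J n *s r n y t"
  "phi n (n + 2) y t J = snd J 0 + fst J n *s r n y t + fst J (n + 1) *s r (n + 1) y t"
  "phi n (n - 1) y t J = snd J 0 - fst J (n - 1) *s r (n - 1) y t"
proof -
  have "{n..<n+1} = {n}" "{n..<n+2} = {n, n+1}" "{n-1..<n} = {n-1}" by auto
  then show
    "phi n n y t J = snd J 0"
    "phi n (n + 1) y t J = snd J 0 + fst J n *s r n y t"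
    "phi n (n + 2) y t J = snd J 0 + fst J n *s r n y t + fst J (n + 1) *s r (n + 1) y t"
    "phi n (n - 1) y t J = snd J 0 - fst J (n - 1) *s r (n - 1) y t"
    by (simp_all add: phi_def psi_def)
qed

text \<open>At \<open>n - 1\<close> the base value is the upper of the two \<open>phi\<close>
  values, so the correction there carries \<open>- \<gamma>\<close> instead of
  \<open>\<delta>\<close>.\<close>

lemma psi_y_near:
  "psi_y n n y t J = (\<gamma> + \<delta>) * (q n y t \<odot> snd J 0) + \<delta> * (q n y t \<odot> r n y t) * fst J n"
  "psi_y n (n + 1) y t J = (\<gamma> + \<delta>) * (q (n + 1) y t \<odot> snd J 0)
     + (\<gamma> + \<delta>) * (q (n + 1) y t \<odot> r n y t) * fst J n
     + \<delta> * (q (n + 1) y t \<odot> r (n + 1) y t) * fst J (n + 1)"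
  "psi_y n (n - 1) y t J = (\<gamma> + \<delta>) * (q (n - 1) y t \<odot> snd J 0)
     - \<gamma> * (q (n - 1) y t \<odot> r (n - 1) y t) * fst J (n - 1)"
  using phi_near(2)[of n y t J] phi_near(3)[of n y t J]
  by (simp_all add: psi_y_def phi_near(1,4) rowcol_linear_simps algebra_simps)

lemma jet_y_simps [simp]:
  "snd (jet_y n y t J) k = snd J (Suc k)" "fst (jet_y n y t J) m = psi_y n m y t J"
  by (simp_all add: jet_y_def)

lemma Dy_phi_base: "Dy n (phi n n) y t J = snd J 1"
  \<comment> \<open>The coefficients are constant in \<open>y\<close>, so the total derivative only
    shifts the jet.\<close>
  by (subst Dy_eqI[where D = 0]) (auto simp: phi_near)

lemma Dy_Dy_phi_base: "Dy n (Dy n (phi n n)) y t J = snd J 2"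
  by (subst Dy_eqI[where D = 0]) (auto simp: Dy_phi_base numeral_2_eq_2)

lemma Dy_phi_next:
  "Dy n (phi n (n + 1)) y t J =
     snd J 1 + fst J n *s dy (r n) y t
     + ((\<gamma> + \<delta>) * (q n y t \<odot> snd J 0) + \<delta> * (q n y t \<odot> r n y t) * fst J n) *s r n y t"
  by (subst Dy_eqI[where D = "fst J n *s dy (r n) y t"])
    (auto simp: phi_near psi_y_near intro!: derivative_eq_intros)

text \<open>Leibniz rule for the second derivative of \<open>phi n n + psi n *s r n\<close>; the
  last bracket is the second \<open>y\<close>-derivative of \<open>psi n\<close>.\<close>

lemma Dy_Dy_phi_next:
  "Dy n (Dy n (phi n (n + 1))) y t J =
     snd J 2 + fst J n *s dy (dy (r n)) y t
     + (2 * psi_y n n y t J) *s dy (r n) y t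
     + ((\<gamma> + \<delta>) * (dy (q n) y t \<odot> snd J 0 + q n y t \<odot> snd J 1)
        + \<delta> * (dy (q n) y t \<odot> r n y t + q n y t \<odot> dy (r n) y t) * fst J n
        + \<delta> * (q n y t \<odot> r n y t) * psi_y n n y t J) *s r n y t"
  \<comment> \<open>The coefficient derivative stays schematic here and is found by the derivative
    rules below.\<close>
  apply (subst Dy_eqI)
   apply (simp only: Dy_phi_next)
   apply (rule derivative_eq_intros refl)+
  apply (subst Dy_phi_next)
  apply (simp add: psi_y_near vec_eq_iff numeral_2_eq_2 algebra_simps rowcol_linear_simps)
  done

section \<open>Time evolution in terms of jets\<close>

lemma psi_t_explicit:
  "psi_t n y t J = (1 / \<i>) *
    (\<alpha> * exp (\<gamma> * logu n y t) * fst J (n - 1)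
     + \<beta> * exp (\<delta> * logu (n + 1) y t) * fst J (n + 1)
     + w n y t * fst J n
     + b * ((\<gamma> + \<delta>) * (q n y t \<odot> snd J 1)
          - (\<gamma> + \<delta>) * ((dy (q n) y t - (\<delta> * (q n y t \<odot> r n y t)) *s q n y t) \<odot> snd J 0)
          - \<delta> * ((dy (q n) y t \<odot> r n y t - q n y t \<odot> dy (r n) y t)
                 + (\<gamma> - \<delta>) * (q n y t \<odot> r n y t)\<^sup>2) * fst J n))"
  by (simp add: psi_t_def upow_def psi_def Dy_phi_base phi_near)

lemma has_dy_upow:
  "((\<lambda>s. exp (c * logu n s t)) has_vector_derivative c * dy (logu n) y t * exp (c * logu n y t)) (at y)"
proof -
  have "((\<lambda>s. c * logu n s t) has_vector_derivative c * dy (logu n) y t) (at y)"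
    by (auto intro!: derivative_eq_intros)
  from field_vector_diff_chain_at[OF this DERIV_exp] show ?thesis
    by (simp add: o_def)
qed

text \<open>Multiplying by \<open>\<i>\<close> here and in the next lemmas clears the factor
  \<open>1 / \<i>\<close> of the evolution equations.\<close>

lemma i_psi_t:
  "\<i> * psi_t n y t J =
    \<alpha> * exp (\<gamma> * logu n y t) * fst J (n - 1)
     + \<beta> * exp (\<delta> * logu (n + 1) y t) * fst J (n + 1)
     + w n y t * fst J n
     + b * ((\<gamma> + \<delta>) * (q n y t \<odot> snd J 1)
          - (\<gamma> + \<delta>) * (dy (q n) y t \<odot> snd J 0 - \<delta> * (q n y t \<odot> r n y t) * (q n y t \<odot> snd J 0))
          - \<delta> * ((dy (q n) y t \<odot> r n y t - q n y t \<odot> dy (r n) y t)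
                 + (\<gamma> - \<delta>) * (q n y t \<odot> r n y t)\<^sup>2) * fst J n)"
  by (simp add: psi_t_explicit rowcol_linear_simps)

lemma i_phi_t_base:
  "\<i> *s phi_t n n y t J =
    - ((\<alpha> * upow \<gamma> n y t * fst J (n - 1)) *s r n y t)
    + (\<beta> * upow \<delta> n y t * fst J n) *s r (n - 1) y t
    + b *s (snd J 2 + (\<gamma> + \<delta>) *s (v n y t *v snd J 0))"
  by (simp add: phi_t_def psi_def Dy_Dy_phi_base phi_near)

lemma i_phi_t_next:
  "\<i> *s phi_t n (n + 1) y t J =
    - ((\<alpha> * upow \<gamma> (n + 1) y t * fst J n) *s r (n + 1) y t)
    + (\<beta> * upow \<delta> (n + 1) y t * fst J (n + 1)) *s r n y t
    + b *s (Dy n (Dy n (phi n (n + 1))) y t J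
        + (\<gamma> + \<delta>) *s (v (n + 1) y t *v (snd J 0 + fst J n *s r n y t)))"
  using phi_near(2)[of n y t J] by (simp add: phi_t_def psi_def)

text \<open>Only the coefficients are differentiated explicitly. The last summand is left as
  \<open>psi_t\<close> at the differentiated jet, so that \<open>i_psi_t\<close> can expand it with
  \<open>psi_y\<close> in place of \<open>psi\<close>.\<close>

lemma i_psi_ty:
  "\<i> * psi_ty n y t J =
     \<alpha> * (\<gamma> * dy (logu n) y t * upow \<gamma> n y t) * fst J (n - 1)
     + \<beta> * (\<delta> * dy (logu (n + 1)) y t * upow \<delta> (n + 1) y t) * fst J (n + 1)
     + dy (w n) y t * fst J n
     + b * ((\<gamma> + \<delta>) * (dy (q n) y t \<odot> snd J 1)
          - (\<gamma> + \<delta>) * (dy (dy (q n)) y t \<odot> snd J 0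
              - \<delta> * (dy (q n) y t \<odot> r n y t + q n y t \<odot> dy (r n) y t) * (q n y t \<odot> snd J 0)
              - \<delta> * (q n y t \<odot> r n y t) * (dy (q n) y t \<odot> snd J 0))
          - \<delta> * ((dy (dy (q n)) y t \<odot> r n y t - q n y t \<odot> dy (dy (r n)) y t)
                 + (\<gamma> - \<delta>) * (2 * (q n y t \<odot> r n y t)
                     * (dy (q n) y t \<odot> r n y t + q n y t \<odot> dy (r n) y t))) * fst J n)
     + \<i> * psi_t n y t (jet_y n y t J)"
  unfolding psi_ty_def
  apply (subst Dy_eqI)
   apply (simp only: psi_t_explicit power2_eq_square)
   apply (rule has_dy_upow derivative_eq_intros refl)+
  apply (simp add: upow_def algebra_simps rowcol_linear_simps)
  done

section \<open>Residuals of the lattice equations and the two defect identities\<close>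

definition res_q where
  "res_q n y t =
       \<i> *s dt (q n) y t - (\<alpha> * upow \<gamma> n y t) *s q (n - 1) y t
         - (\<beta> * upow \<delta> (n + 1) y t) *s q (n + 1) y t - w n y t *s q n y t
         + b *s (dy (dy (q n)) y t + q n y t v* (\<gamma> *\<^sub>m v n y t + \<delta> *\<^sub>m v (n + 1) y t)
                 + (\<gamma> * \<delta> * (q n y t \<odot> r n y t)\<^sup>2) *s q n y t)"

definition res_r where
  "res_r n y t = 
        \<i> *s dt (r n) y t + (\<beta> * upow \<delta> n y t) *s r (n - 1) y t
         + (\<alpha> * upow \<gamma> (n + 1) y t) *s r (n + 1) y t + w n y t *s r n y t
         - b *s (dy (dy (r n)) y t + (\<delta> *\<^sub>m v n y t + \<gamma> *\<^sub>m v (n + 1) y t) *v r n y t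
                 + (\<gamma> * \<delta> * (q n y t \<odot> r n y t)\<^sup>2) *s r n y t)"

text \<open>The equation for \<open>u\<close> enters through \<open>(log u)\<^sub>y\<close>, which is what the powers \<open>u\<^sup>c\<close> produce.\<close>

definition res_u where
  "res_u n y t = dy (logu n) y t - (q (n - 1) y t \<odot> r (n - 1) y t - q n y t \<odot> r n y t)"

definition res_w where
  "res_w n y t = dy (w n) y t -
         (\<alpha> * \<delta> * (upow \<gamma> n y t * (q (n - 1) y t \<odot> r n y t)
                  - upow \<gamma> (n + 1) y t * (q n y t \<odot> r (n + 1) y t))
         + \<beta> * \<gamma> * (upow \<delta> n y t * (q n y t \<odot> r (n - 1) y t)
                    - upow \<delta> (n + 1) y t * (q (n + 1) y t \<odot> r n y t)))"

definition res_v where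
  "res_v n y t = v (n + 1) y t - v n y t + 2 *\<^sub>R dy (\<lambda>y t. outer (r n y t) (q n y t)) y t"

text \<open>The matrix residual enters the defects only through its action on vectors, where the
  derivative of the outer product splits by the Leibniz rule.\<close>

lemma res_v_vector:
  "res_v n y t *v x = v (n + 1) y t *v x - v n y t *v x
     + 2 *s ((q n y t \<odot> x) *s dy (r n) y t + (dy (q n) y t \<odot> x) *s r n y t)"
proof -
  have dy_outer: "dy (\<lambda>y t. outer (r n y t) (q n y t)) y t =
      outer (r n y t) (dy (q n) y t) + outer (dy (r n) y t) (q n y t)"
    by (rule dy_eqI) (rule derivative_eq_intros refl)+
  show ?thesis
    unfolding res_v_def dy_outer scaleR_2 matrix_vector_mult_add_rdistrib
      matrix_vector_mult_diff_rdistrib outer_vector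
    by (simp add: vec_eq_iff algebra_simps)
qed

text \<open>The derivatives of \<open>phi\<close> cancel. The evolution yields
  \<open>(\<gamma> + \<delta>) *s (v (n + 1) y t *v r n y t)\<close> where \<open>res_r\<close> has
  a mixture of \<open>v n\<close> and \<open>v (n + 1)\<close>; the term with
  \<open>b * \<delta>\<close> accounts for the difference.\<close>

lemma shift_t_residual:
  "\<i> *s shift_t n y t J =
     fst J n *s (res_r n y t - (b * \<delta>) *s (res_v n y t *v r n y t))
     - (b * (\<gamma> + \<delta>)) *s (res_v n y t *v snd J 0)"
proof -
  have "\<i> *s shift_t n y t J = fst J n *s (\<i> *s dt (r n) y t) + (\<i> * psi_t n y t J) *s r n y t
     + \<i> *s phi_t n n y t J - \<i> *s phi_t n (n + 1) y t J"
    by (simp add: shift_t_def psi_def vec_eq_iff algebra_simps)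
  then show ?thesis
    unfolding i_psi_t i_phi_t_base i_phi_t_next Dy_Dy_phi_next res_r_def res_v_vector psi_y_near
      upow_def[symmetric]
    by (simp add: vec_eq_iff matrix_vector_mult_add_rdistrib matrix_vector_right_distrib
      matscale_vector vector_scalar_commute algebra_simps power2_eq_square)
qed

text \<open>At \<open>psi (n - 1)\<close>, \<open>res_u n\<close> collects three contributions: the
  derivative of the power of \<open>u\<close>, \<open>psi_y\<close> at that neighbour, and
  \<open>q n\<close> paired with \<open>phi_t\<close>. The same happens at
  \<open>psi (n + 1)\<close> with \<open>res_u (n + 1)\<close>. The term with
  \<open>b * \<gamma> * \<delta>\<close> again exchanges \<open>v n\<close> for
  \<open>v (n + 1)\<close>.\<close>

lemma psi_cross_residual:
  "\<i> * (psi_yt n y t J - psi_ty n y t J) =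
     (\<gamma> + \<delta>) * (res_q n y t \<odot> snd J 0)
     + fst J n * (\<delta> * (res_q n y t \<odot> r n y t) - res_w n y t
                  + b * \<gamma> * \<delta> * (q n y t \<odot> (res_v n y t *v r n y t)))
     - \<alpha> * \<gamma> * upow \<gamma> n y t * res_u n y t * fst J (n - 1)
     - \<beta> * \<delta> * upow \<delta> (n + 1) y t * res_u (n + 1) y t * fst J (n + 1)"
proof -
  have "\<i> * (psi_yt n y t J - psi_ty n y t J) =
    (\<i> *s dt (q n) y t) \<odot> (\<gamma> *s snd J 0 + \<delta> *s (snd J 0 + fst J n *s r n y t))
    + q n y t \<odot> (\<gamma> *s (\<i> *s phi_t n n y t J) + \<delta> *s (\<i> *s phi_t n (n + 1) y t J)) - \<i> * psi_ty n y t J"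
    unfolding psi_yt_def phi_near by (simp add: algebra_simps rowcol_linear_simps)
  also have "\<dots> =
     (\<gamma> + \<delta>) * (res_q n y t \<odot> snd J 0)
     + fst J n * (\<delta> * (res_q n y t \<odot> r n y t) - res_w n y t
                  + b * \<gamma> * \<delta> * (q n y t \<odot> (res_v n y t *v r n y t)))
     - \<alpha> * \<gamma> * upow \<gamma> n y t * res_u n y t * fst J (n - 1)
     - \<beta> * \<delta> * upow \<delta> (n + 1) y t * res_u (n + 1) y t * fst J (n + 1)"
    unfolding i_psi_ty i_psi_t i_phi_t_base i_phi_t_next Dy_Dy_phi_next res_q_def res_v_vector psi_y_near
      upow_def[symmetric] res_w_def res_u_def jet_y_simps vector_matscale_combination
    by (simp add: rowcol_linear_simps rowcol_matrix_vector matrix_vector_mult_add_rdistrib matrix_vector_right_distrib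
      matscale_vector vector_scalar_commute algebra_simps power2_eq_square numeral_2_eq_2)
  finally show ?thesis .
qed

section \<open>Extraction of coefficients by test jets\<close>

lemma compatible_iff:
  assumes "\<gamma> + \<delta> \<noteq> 0" "(\<alpha> * \<gamma>, \<beta> * \<delta>) \<noteq> (0, 0)" "b \<noteq> 0"
  shows "compatible \<longleftrightarrow> (\<forall>n y t. res_q n y t = 0 \<and> res_r n y t = 0 \<and> res_u n y t = 0
    \<and> res_w n y t = 0 \<and> res_v n y t = 0)"
proof
  assume "\<forall>n y t. res_q n y t = 0 \<and> res_r n y t = 0 \<and> res_u n y t = 0
    \<and> res_w n y t = 0 \<and> res_v n y t = 0"
  then have "\<i> *s shift_t n y t J = 0" "\<i> * (psi_yt n y t J - psi_ty n y t J) = 0" for n y t and J :: "'a jet"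
    by (simp_all add: shift_t_residual psi_cross_residual rowcol_linear_simps)
  then show compatible
    by (simp add: compatible_def)
next
  assume compatible
  then have compat: "psi_yt n y t J = psi_ty n y t J" "shift_t n y t J = 0" for n y t and J :: "'a jet"
    unfolding compatible_def by blast+
  have shift: "fst J n *s (res_r n y t - (b * \<delta>) *s (res_v n y t *v r n y t))
      = (b * (\<gamma> + \<delta>)) *s (res_v n y t *v snd J 0)"
    and cross: "(\<gamma> + \<delta>) * (res_q n y t \<odot> snd J 0)
     + fst J n * (\<delta> * (res_q n y t \<odot> r n y t) - res_w n y t
                  + b * \<gamma> * \<delta> * (q n y t \<odot> (res_v n y t *v r n y t)))
     = \<alpha> * \<gamma> * upow \<gamma> n y t * res_u n y t * fst J (n - 1)
     + \<beta> * \<delta> * upow \<delta> (n + 1) y t * res_u (n + 1) y t * fst J (n + 1)" for n y t and J :: "'a jet"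
    using shift_t_residual[of n y t J] psi_cross_residual[of n y t J]
    by (simp_all add: compat algebra_simps)
  have v: "res_v n y t = 0" for n y t
  proof -
    have "res_v n y t *v x = 0" for x
      \<comment> \<open>With all \<open>psi\<close> zero only the \<open>phi\<close> term is left,
        and its factor \<open>b * (\<gamma> + \<delta>)\<close> is nonzero.\<close>
      using shift[of "(\<lambda>_. 0, \<lambda>_. x)" n y t] assms by simp
    then show ?thesis
      by (simp add: matrix_eq)
  qed
  have r: "res_r n y t = 0" for n y t
    using shift[of "(\<lambda>_. 1, \<lambda>_. 0)" n y t] v by simp
  have q: "res_q n y t = 0" for n y t
  proof (rule rowcol_eq_0_imp)
    show "res_q n y t \<odot> x = 0" for x
      using cross[of n y t "(\<lambda>_. 0, \<lambda>_. x)"] assms by simp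
  qed
  have w: "res_w n y t = 0" for n y t
    \<comment> \<open>The jet must vanish at both neighbours of \<open>n\<close>, where the not yet
      eliminated \<open>res_u\<close> terms sit.\<close>
    using cross[of n y t "(\<lambda>m. of_bool (m = n), \<lambda>_. 0)"] q v by (simp add: rowcol_linear_simps)
  have "\<alpha> * \<gamma> * res_u n y t = 0" for n y t
    using cross[of n y t "(\<lambda>m. of_bool (m = n - 1), \<lambda>_. 0)"] by (simp add: rowcol_linear_simps upow_def)
  moreover have "\<beta> * \<delta> * res_u n y t = 0" for n y t
    \<comment> \<open>Basing the identity at \<open>n - 1\<close> makes its upper neighbour the site
      \<open>n\<close>, so both facts concern the same \<open>res_u n\<close>.\<close>
    using cross[of "n - 1" y t "(\<lambda>m. of_bool (m = n), \<lambda>_. 0)"] by (simp add: rowcol_linear_simps upow_def)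
  ultimately have "res_u n y t = 0" for n y t
    using assms(2) by (metis mult_eq_0_iff)
  with q r v w show "\<forall>n y t. res_q n y t = 0 \<and> res_r n y t = 0 \<and> res_u n y t = 0
    \<and> res_w n y t = 0 \<and> res_v n y t = 0"
    by simp
qed

end

theorem proposition3p2:
  fixes \<alpha> \<beta> \<gamma> \<delta> b :: complex
    and q r :: "int \<Rightarrow> real \<Rightarrow> real \<Rightarrow> complex ^ 'm"
    and u logu w :: "int \<Rightarrow> real \<Rightarrow> real \<Rightarrow> complex"
    and v :: "int \<Rightarrow> real \<Rightarrow> real \<Rightarrow> complex ^ 'm ^ 'm"
  defines "upow \<equiv> lax_pair.upow logu"
  assumes "\<gamma> + \<delta> \<noteq> 0"
    and "(\<alpha> * \<gamma>, \<beta> * \<delta>) \<noteq> (0, 0)"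
    and "b \<noteq> 0"
    and "\<And>n. smooth (q n)" and "\<And>n. smooth (r n)" and "\<And>n. smooth (u n)"
    and "\<And>n. smooth (w n)" and "\<And>n. smooth (v n)"
    and "\<And>n y t. u n y t \<noteq> 0"
    and "\<And>n. smooth (logu n)" and "\<And>n y t. exp (logu n y t) = u n y t"
  shows "lax_pair.compatible \<alpha> \<beta> \<gamma> \<delta> b q r logu w v \<longleftrightarrow>
    (\<forall>n y t.
       \<i> *s dt (q n) y t - (\<alpha> * upow \<gamma> n y t) *s q (n - 1) y t
         - (\<beta> * upow \<delta> (n + 1) y t) *s q (n + 1) y t - w n y t *s q n y t
         + b *s (dy (dy (q n)) y t + q n y t v* (\<gamma> *\<^sub>m v n y t + \<delta> *\<^sub>m v (n + 1) y t)
                 + (\<gamma> * \<delta> * (q n y t \<odot> r n y t)\<^sup>2) *s q n y t) = 0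
     \<and> \<i> *s dt (r n) y t + (\<beta> * upow \<delta> n y t) *s r (n - 1) y t
         + (\<alpha> * upow \<gamma> (n + 1) y t) *s r (n + 1) y t + w n y t *s r n y t
         - b *s (dy (dy (r n)) y t + (\<delta> *\<^sub>m v n y t + \<gamma> *\<^sub>m v (n + 1) y t) *v r n y t
                 + (\<gamma> * \<delta> * (q n y t \<odot> r n y t)\<^sup>2) *s r n y t) = 0
     \<and> dy (u n) y t = u n y t * (q (n - 1) y t \<odot> r (n - 1) y t - q n y t \<odot> r n y t)
     \<and> dy (w n) y t =
         \<alpha> * \<delta> * (upow \<gamma> n y t * (q (n - 1) y t \<odot> r n y t)
                  - upow \<gamma> (n + 1) y t * (q n y t \<odot> r (n + 1) y t))
         + \<beta> * \<gamma> * (upow \<delta> n y t * (q n y t \<odot> r (n - 1) y t)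
                    - upow \<delta> (n + 1) y t * (q (n + 1) y t \<odot> r n y t))
     \<and> v (n + 1) y t - v n y t = - 2 *\<^sub>R dy (\<lambda>y t. outer (r n y t) (q n y t)) y t)"
proof -
  interpret smooth_lax_pair \<alpha> \<beta> \<gamma> \<delta> b q r logu w v
    using assms by unfold_locales auto
  \<comment> \<open>Links the equation for \<open>u\<close> to that for its logarithm: the two
    differ by the nowhere vanishing factor \<open>u\<close>.\<close>
  have dy_u: "dy (u n) y t = u n y t * dy (logu n) y t" for n y t
  proof (rule dy_eqI)
    \<comment> \<open>Exponent 1 brings \<open>u\<close> into the form to which
      \<open>has_dy_upow\<close> applies.\<close>
    have "(\<lambda>s. u n s t) = (\<lambda>s. exp (1 * logu n s t))"
      using assms by simp
    then show "((\<lambda>s. u n s t) has_vector_derivative u n y t * dy (logu n) y t) (at y)"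
      using has_dy_upow[of 1 n t y] assms by (simp add: mult.commute)
  qed
  have "res_u n y t = 0 \<longleftrightarrow>
      dy (u n) y t = u n y t * (q (n - 1) y t \<odot> r (n - 1) y t - q n y t \<odot> r n y t)" for n y t
    using assms by (simp add: res_u_def dy_u)
  moreover have "res_v n y t = 0 \<longleftrightarrow>
      v (n + 1) y t - v n y t = - 2 *\<^sub>R dy (\<lambda>y t. outer (r n y t) (q n y t)) y t" for n y t
    by (simp add: res_v_def eq_neg_iff_add_eq_0)
  moreover have "res_w n y t = 0 \<longleftrightarrow> dy (w n) y t =
         \<alpha> * \<delta> * (upow \<gamma> n y t * (q (n - 1) y t \<odot> r n y t)
                  - upow \<gamma> (n + 1) y t * (q n y t \<odot> r (n + 1) y t))
         + \<beta> * \<gamma> * (upow \<delta> n y t * (q n y t \<odot> r (n - 1) y t)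
                    - upow \<delta> (n + 1) y t * (q (n + 1) y t \<odot> r n y t))" for n y t
    by (simp add: res_w_def assms(1))
  ultimately show ?thesis
    \<comment> \<open>Here \<open>assms(1)\<close> is the defining equation of \<open>upow\<close>
      from the \<open>defines\<close> clause.\<close>
    unfolding compatible_iff[OF assms(2-4)] by (simp only: res_q_def res_r_def assms(1))
qed

end
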